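(* Let $(X,p,E)$ be a lattice-normed space, where $(E,\|\cdot\|_E)$ is an $AM$-space with a strong unit, and let $(Y,m,F)$ be a lattice-normed space, where $(F,\|\cdot\|_F)$ is an order continuous normed lattice. Let $T:X\to Y$ be linear. If $T:(X,p,E)\to(Y,m,F)$ is sequentially $p$-compact, then $T:(X,p\text{-}\|\cdot\|_E)\to(Y,m\text{-}\|\cdot\|_F)$ is compact.
   Context: All vector lattices are real and Archimedean. A net $(x_\alpha)$ in a vector lattice $X$ order converges to $x$ (written $x_\alpha\xrightarrow{o}x$) if there is a net $(y_\beta)_{\beta\in B}$ (possibly with a different index set) with $y_\beta\downarrow 0$ such that for every $\beta$ there is $\alpha_\beta$ with $|x_\alpha-x|\le y_\beta$ for all $\alpha\ge\alpha_\beta$. A lattice-normed space (LNS) is a triple $(X,p,E)$ with $X$ a real vector space, $E$ a vector lattice and $p:X\to E_+$ such that $p(x)=0\Leftrightarrow x=0$, $p(\lambda x)=|\lambda|p(x)$, $p(x+y)\le p(x)+p(y)$. A net $x_\alpha$ $p$-converges to $x$ (written $x_\alpha\xrightarrow{p}x$) if $p(x_\alpha-x)\xrightarrow{o}0$ in $E$. A sequence $x_n$ in $X$ is $p$-bounded if there is $e\in E$ with $p(x_n)\le e$ for all $n$. A linear operator $T:(X,p,E)\to(Y,m,F)$ is sequentially $p$-compact if for every $p$-bounded sequence $x_n$ in $X$ there are a subsequence $x_{n_k}$ and $y\in Y$ with $Tx_{n_k}\xrightarrow{p}y$. If $(E,\|\cdot\|_E)$ is a normed lattice, the mixed norm on $X$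 is $p\text{-}\|x\|_E=\|p(x)\|_E$; similarly $m\text{-}\|y\|_F=\|m(y)\|_F$. A linear operator between normed spaces is compact if it maps the closed unit ball to a relatively compact set; equivalently (as the paper takes it), the image of every norm bounded sequence has a convergent subsequence. An $AM$-space is a Banach lattice with $\|x\vee y\|=\max\{\|x\|,\|y\|\}$ whenever $x\wedge y=0$; a strong unit is an element $e>0$ such that the ideal generated by $e$ is the whole space. A normed lattice is order continuous if every net order converging to $0$ converges to $0$ in norm. *)

theory Defs
  imports "HOL-Analysis.Analysis" "HOL-Library.Lattice_Algebras"
begin

section \<open>Vector lattices and normed lattices\<close>

class vector_lattice = ordered_real_vector + lattice_ab_group_add_abs

(* The axiom says that, for 0 \<le> x, the infimum of x / n over n \<ge> 1 is 0. *)
class archimedean_vector_lattice = vector_lattice +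
  assumes archimedean: "0 \<le> x \<Longrightarrow> (\<And>n::nat. l \<le> (1 / real (Suc n)) *\<^sub>R x) \<Longrightarrow> l \<le> 0"

class normed_lattice = vector_lattice + real_normed_vector +
  assumes norm_mono_abs: "\<bar>x\<bar> \<le> \<bar>y\<bar> \<Longrightarrow> norm x \<le> norm y"

instance normed_lattice \<subseteq> archimedean_vector_lattice
proof
  fix x l :: 'a
  assume x: "0 \<le> x" and l: "\<And>n::nat. l \<le> (1 / real (Suc n)) *\<^sub>R x"
  define u where "u = sup l 0"
  have u0: "0 \<le> u" by (simp add: u_def)
  have "norm u \<le> (1 / real (Suc n)) * norm x" for n
  proof -
    have s: "0 \<le> (1 / real (Suc n)) *\<^sub>R x"
      by (rule scaleR_nonneg_nonneg) (use x in auto)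
    have "u \<le> (1 / real (Suc n)) *\<^sub>R x"
      unfolding u_def by (rule sup_least[OF l s])
    then have "\<bar>u\<bar> \<le> \<bar>(1 / real (Suc n)) *\<^sub>R x\<bar>"
      using s u0 by simp
    then have "norm u \<le> norm ((1 / real (Suc n)) *\<^sub>R x)" by (rule norm_mono_abs)
    then show ?thesis by simp
  qed
  moreover have "(\<lambda>n. (1 / real (Suc n)) * norm x) \<longlonglongrightarrow> 0"
    using tendsto_mult_left_zero[OF LIMSEQ_inverse_real_of_nat] by (simp add: inverse_eq_divide)
  ultimately have "norm u \<le> 0"
    by (intro LIMSEQ_le_const) auto
  then have "u = 0" by simp
  then show "l \<le> 0" unfolding u_def by (metis sup_ge1)
qed

class banach_lattice = normed_lattice + complete_space

class am_space = banach_lattice +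
  assumes norm_sup_disjoint: "inf x y = 0 \<Longrightarrow> norm (sup x y) = max (norm x) (norm y)"

definition order_ideal :: "'e::vector_lattice set \<Rightarrow> bool" where
  "order_ideal I \<longleftrightarrow> subspace I \<and> (\<forall>x y. \<bar>x\<bar> \<le> \<bar>y\<bar> \<and> y \<in> I \<longrightarrow> x \<in> I)"

definition generated_ideal :: "'e::vector_lattice set \<Rightarrow> 'e set" where
  "generated_ideal S = \<Inter>{I. order_ideal I \<and> S \<subseteq> I}"

definition strong_unit :: "'e::vector_lattice \<Rightarrow> bool" where
  "strong_unit e \<longleftrightarrow> 0 < e \<and> generated_ideal {e} = UNIV"

section \<open>Nets and order convergence\<close>

text \<open>A net is a function on a set \<open>A\<close> directed by the preorder \<open>le\<close>.\<close>

definition directed_index :: "'i set \<Rightarrow> ('i \<Rightarrow> 'i \<Rightarrow> bool) \<Rightarrow> bool" where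
  "directed_index A le \<longleftrightarrow> A \<noteq> {} \<and>
     (\<forall>a\<in>A. le a a) \<and>
     (\<forall>a\<in>A. \<forall>b\<in>A. \<forall>c\<in>A. le a b \<longrightarrow> le b c \<longrightarrow> le a c) \<and>
     (\<forall>a\<in>A. \<forall>b\<in>A. \<exists>c\<in>A. le a c \<and> le b c)"

definition decreases_to_zero ::
    "'j set \<Rightarrow> ('j \<Rightarrow> 'j \<Rightarrow> bool) \<Rightarrow> ('j \<Rightarrow> 'e::vector_lattice) \<Rightarrow> bool" where
  "decreases_to_zero B le y \<longleftrightarrow> directed_index B le \<and>
     (\<forall>b\<in>B. \<forall>c\<in>B. le b c \<longrightarrow> y c \<le> y b) \<and>
     (\<forall>b\<in>B. 0 \<le> y b) \<and>
     (\<forall>l. (\<forall>b\<in>B. l \<le> y b) \<longrightarrow> l \<le> 0)"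

text \<open>Types cannot be quantified existentially, so the index set of the dominating net \<open>y\<close>
  ranges over the directed subsets of \<open>'e\<close>. This is no restriction, since a decreasing net can be
  reindexed by its range; see \<open>order_convergesI\<close> below.\<close>

definition order_converges ::
    "'i set \<Rightarrow> ('i \<Rightarrow> 'i \<Rightarrow> bool) \<Rightarrow> ('i \<Rightarrow> 'e::vector_lattice) \<Rightarrow> 'e \<Rightarrow> bool" where
  "order_converges A le x l \<longleftrightarrow>
     (\<exists>(B :: 'e set) leB y. decreases_to_zero B leB y \<and>
        (\<forall>b\<in>B. \<exists>a0\<in>A. \<forall>a\<in>A. le a0 a \<longrightarrow> \<bar>x a - l\<bar> \<le> y b))"

lemma decreases_to_zero_range:
  fixes y :: "'j \<Rightarrow> 'e::vector_lattice"
  assumes "decreases_to_zero B le y"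
  shows "decreases_to_zero (y ` B) (\<lambda>u v. v \<le> u) (\<lambda>u. u)"
proof -
  have dir: "directed_index B le"
    and mono: "\<And>b c. b \<in> B \<Longrightarrow> c \<in> B \<Longrightarrow> le b c \<Longrightarrow> y c \<le> y b"
    and pos: "\<forall>b\<in>B. 0 \<le> y b" and inf: "\<forall>l. (\<forall>b\<in>B. l \<le> y b) \<longrightarrow> l \<le> 0"
    using assms unfolding decreases_to_zero_def by (elim conjE; blast)+
  have B: "B \<noteq> {}" and up: "\<And>a b. a \<in> B \<Longrightarrow> b \<in> B \<Longrightarrow> \<exists>c\<in>B. le a c \<and> le b c"
    using dir unfolding directed_index_def by (elim conjE; blast)+
  have "\<exists>w\<in>y ` B. w \<le> u \<and> w \<le> v" if "u \<in> y ` B" "v \<in> y ` B" for u v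
  proof -
    from that obtain a b where ab: "a \<in> B" "b \<in> B" "u = y a" "v = y b" by (elim imageE)
    from up[OF ab(1,2)] obtain c where c: "c \<in> B" "le a c" "le b c" by (elim bexE conjE)
    show ?thesis
      using mono[OF ab(1) c(1,2)] mono[OF ab(2) c(1,3)] unfolding ab(3,4)
      by (intro bexI[of _ "y c"] conjI imageI c(1))
  qed
  then have "directed_index (y ` B) (\<lambda>u v. v \<le> u)"
    using B unfolding directed_index_def
    by (intro conjI ballI impI) (simp_all only: image_is_empty order_refl not_False_eq_True order_trans)
  then show ?thesis
    using pos inf unfolding decreases_to_zero_def by simp
qed

lemma order_convergesI:
  fixes x :: "'i \<Rightarrow> 'e::vector_lattice" and y :: "'j \<Rightarrow> 'e"
  assumes y: "decreases_to_zero B leB y"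
    and dom: "\<And>b. b \<in> B \<Longrightarrow> \<exists>a0\<in>A. \<forall>a\<in>A. le a0 a \<longrightarrow> \<bar>x a - l\<bar> \<le> y b"
  shows "order_converges A le x l"
  unfolding order_converges_def
  by (intro exI conjI, rule decreases_to_zero_range[OF y]) (use dom in auto)

text \<open>Order continuity of the norm. By \<open>order_continuous_norm_any_net\<close>, indexing the nets by
  subsets of \<open>'f\<close> gives the same notion as arbitrary index sets.\<close>

definition order_continuous_norm :: "'f::normed_lattice itself \<Rightarrow> bool" where
  "order_continuous_norm _ \<longleftrightarrow>
     (\<forall>(A :: 'f set) le (x :: 'f \<Rightarrow> 'f).
        directed_index A le \<longrightarrow> order_converges A le x 0 \<longrightarrow>
        (\<forall>\<epsilon>>0. \<exists>a0\<in>A. \<forall>a\<in>A. le a0 a \<longrightarrow> norm (x a) < \<epsilon>))"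

lemma order_continuous_norm_any_net:
  fixes x :: "'i \<Rightarrow> 'f::normed_lattice"
  assumes oc: "order_continuous_norm TYPE('f)"
    and x: "order_converges A le x 0" and \<epsilon>: "\<epsilon> > 0"
  shows "\<exists>a0\<in>A. \<forall>a\<in>A. le a0 a \<longrightarrow> norm (x a) < \<epsilon>"
proof -
  obtain B :: "'f set" and leB y where y: "decreases_to_zero B leB y"
    and dom: "\<And>b. b \<in> B \<Longrightarrow> \<exists>a0\<in>A. \<forall>a\<in>A. le a0 a \<longrightarrow> \<bar>x a\<bar> \<le> y b"
    using x unfolding order_converges_def by auto
  have dir: "directed_index B leB" and pos: "\<And>b. b \<in> B \<Longrightarrow> 0 \<le> y b"
    and mono: "\<And>b c. b \<in> B \<Longrightarrow> c \<in> B \<Longrightarrow> leB b c \<Longrightarrow> y c \<le> y b"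
    using y unfolding decreases_to_zero_def by auto
  have "order_converges B leB y 0"
  proof (rule order_convergesI[OF y])
    fix b assume b: "b \<in> B"
    show "\<exists>a0\<in>B. \<forall>a\<in>B. leB a0 a \<longrightarrow> \<bar>y a - 0\<bar> \<le> y b"
      using b mono pos by (intro bexI[of _ b]) auto
  qed
  then obtain b where b: "b \<in> B" "\<And>c. c \<in> B \<Longrightarrow> leB b c \<Longrightarrow> norm (y c) < \<epsilon>"
    using oc dir \<epsilon> unfolding order_continuous_norm_def by blast
  then have yb: "norm (y b) < \<epsilon>"
    using dir unfolding directed_index_def by blast
  obtain a0 where a0: "a0 \<in> A" "\<And>a. a \<in> A \<Longrightarrow> le a0 a \<Longrightarrow> \<bar>x a\<bar> \<le> y b"
    using dom[OF b(1)] by blast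
  have "norm (x a) < \<epsilon>" if "a \<in> A" "le a0 a" for a
  proof -
    have "\<bar>x a\<bar> \<le> \<bar>y b\<bar>" using a0(2)[OF that] pos[OF b(1)] by simp
    then show ?thesis using norm_mono_abs yb by (meson le_less_trans)
  qed
  with a0(1) show ?thesis by blast
qed

section \<open>Lattice-normed spaces\<close>

locale lattice_normed_space =
  fixes p :: "'x::real_vector \<Rightarrow> 'e::archimedean_vector_lattice"
  assumes nonneg: "0 \<le> p x"
    and zero_iff: "p x = 0 \<longleftrightarrow> x = 0"
    and scale: "p (c *\<^sub>R x) = \<bar>c\<bar> *\<^sub>R p x"
    and triangle: "p (x + y) \<le> p x + p y"

definition p_converges ::
    "('x::real_vector \<Rightarrow> 'e::archimedean_vector_lattice) \<Rightarrow>
     'i set \<Rightarrow> ('i \<Rightarrow> 'i \<Rightarrow> bool) \<Rightarrow> ('i \<Rightarrow> 'x) \<Rightarrow> 'x \<Rightarrow> bool" where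
  "p_converges p A le x l \<longleftrightarrow> order_converges A le (\<lambda>a. p (x a - l)) 0"

definition p_bounded ::
    "('x::real_vector \<Rightarrow> 'e::archimedean_vector_lattice) \<Rightarrow> (nat \<Rightarrow> 'x) \<Rightarrow> bool" where
  "p_bounded p x \<longleftrightarrow> (\<exists>e. \<forall>n. p (x n) \<le> e)"

definition sequentially_p_compact ::
    "('x::real_vector \<Rightarrow> 'e::archimedean_vector_lattice) \<Rightarrow>
     ('y::real_vector \<Rightarrow> 'f::archimedean_vector_lattice) \<Rightarrow> ('x \<Rightarrow> 'y) \<Rightarrow> bool" where
  "sequentially_p_compact p m T \<longleftrightarrow>
     (\<forall>x. p_bounded p x \<longrightarrow>
        (\<exists>r y. strict_mono r \<and> p_converges m (UNIV :: nat set) (\<le>) (\<lambda>k. T (x (r k))) y))"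

definition mixed_norm ::
    "('x::real_vector \<Rightarrow> 'e::normed_lattice) \<Rightarrow> 'x \<Rightarrow> real" where
  "mixed_norm p x = norm (p x)"

section \<open>Compact operators\<close>

text \<open>The norms are explicit functions because the mixed norm is not the norm of a type class.\<close>

locale vector_norm =
  fixes N :: "'x::real_vector \<Rightarrow> real"
  assumes zero_iff: "N x = 0 \<longleftrightarrow> x = 0"
    and scale: "N (c *\<^sub>R x) = \<bar>c\<bar> * N x"
    and triangle: "N (x + y) \<le> N x + N y"
begin

lemma minus: "N (- x) = N x"
  using scale[of "-1" x] by simp

lemma nonneg: "0 \<le> N x"
  using triangle[of x "- x"] zero_iff[of 0] by (simp add: minus)

sublocale Metric_space UNIV "\<lambda>x y. N (x - y)"
proof
  show "N (x - y) = N (y - x)" for x y using minus[of "x - y"] by simp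
  show "N (x - z) \<le> N (x - y) + N (y - z)" for x y z
    using triangle[of "x - y" "y - z"] by simp
qed (simp_all add: nonneg zero_iff)

end

lemma vector_norm_mixed_norm:
  assumes "lattice_normed_space p"
  shows "vector_norm (mixed_norm p)"
proof -
  interpret lattice_normed_space p by fact
  show ?thesis
  proof
    fix x y c
    show "mixed_norm p x = 0 \<longleftrightarrow> x = 0" by (simp add: mixed_norm_def zero_iff)
    show "mixed_norm p (c *\<^sub>R x) = \<bar>c\<bar> * mixed_norm p x" by (simp add: mixed_norm_def scale)
    have "\<bar>p (x + y)\<bar> \<le> \<bar>p x + p y\<bar>"
      using triangle[of x y] nonneg by (simp add: add_nonneg_nonneg)
    then have "norm (p (x + y)) \<le> norm (p x + p y)" by (rule norm_mono_abs)
    also have "\<dots> \<le> norm (p x) + norm (p y)" by (rule norm_triangle_ineq)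
    finally show "mixed_norm p (x + y) \<le> mixed_norm p x + mixed_norm p y"
      by (simp add: mixed_norm_def)
  qed
qed

definition compact_operator ::
    "('x::real_vector \<Rightarrow> real) \<Rightarrow> ('y::real_vector \<Rightarrow> real) \<Rightarrow> ('x \<Rightarrow> 'y) \<Rightarrow> bool" where
  "compact_operator N M T \<longleftrightarrow>
     (\<forall>x :: nat \<Rightarrow> 'x. (\<exists>C. \<forall>n. N (x n) \<le> C) \<longrightarrow>
        (\<exists>r y. strict_mono r \<and> (\<lambda>k. M (T (x (r k)) - y)) \<longlonglongrightarrow> 0))"

text \<open>The sequential definition agrees with relative compactness of the image of the closed unit
  ball.\<close>

lemma compact_operator_iff_relatively_compact:
  fixes T :: "'x::real_vector \<Rightarrow> 'y::real_vector"
  assumes N: "vector_norm N" and M: "vector_norm M" and T: "linear T"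
  defines "S \<equiv> Metric_space.mtopology UNIV (\<lambda>u v. M (u - v))"
  shows "compact_operator N M T \<longleftrightarrow> compactin S (S closure_of (T ` {x. N x \<le> 1}))"
proof -
  interpret N: vector_norm N by fact
  interpret M: vector_norm M by fact
  let ?I = "T ` {x. N x \<le> 1}"
  have lim: "limitin S \<sigma> l sequentially \<longleftrightarrow> (\<lambda>k. M (\<sigma> k - l)) \<longlonglongrightarrow> 0" for \<sigma> l
    unfolding S_def M.limitin_metric_dist_null by simp
  have cl: "S closure_of ?I = {u. \<forall>r>0. \<exists>v\<in>?I. M (u - v) < r}"
    unfolding S_def M.metric_closure_of by simp
  have cpt: "compactin S K \<longleftrightarrow> (\<forall>\<sigma>::nat \<Rightarrow> 'y. range \<sigma> \<subseteq> K \<longrightarrow>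
      (\<exists>l r. l \<in> K \<and> strict_mono r \<and> limitin S (\<sigma> \<circ> r) l sequentially))" for K
    unfolding S_def M.compactin_sequentially by simp
  show ?thesis
  proof
    assume c: "compact_operator N M T"
    show "compactin S (S closure_of ?I)"
      unfolding cpt
    proof (intro allI impI)
      fix \<sigma> :: "nat \<Rightarrow> 'y" assume \<sigma>: "range \<sigma> \<subseteq> S closure_of ?I"
      have "\<exists>x. N x \<le> 1 \<and> M (\<sigma> n - T x) < inverse (real (Suc n))" for n
      proof -
        have "\<sigma> n \<in> S closure_of ?I" using \<sigma> by auto
        then have "\<exists>v\<in>?I. M (\<sigma> n - v) < inverse (real (Suc n))"
          unfolding cl mem_Collect_eq by (rule allE[of _ "inverse (real (Suc n))"]) simp
        then show ?thesis by blast
      qed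
      then obtain x where x: "\<And>n. N (x n) \<le> 1"
        and \<sigma>x: "\<And>n. M (\<sigma> n - T (x n)) < inverse (real (Suc n))" by metis
      from c x obtain r y where r: "strict_mono r" and y: "(\<lambda>k. M (T (x (r k)) - y)) \<longlonglongrightarrow> 0"
        unfolding compact_operator_def by blast
      have z: "(\<lambda>k. inverse (real (Suc (r k))) + M (T (x (r k)) - y)) \<longlonglongrightarrow> 0"
        using tendsto_add[OF LIMSEQ_subseq_LIMSEQ[OF LIMSEQ_inverse_real_of_nat r] y]
        by (simp add: o_def)
      have "(\<lambda>k. M (\<sigma> (r k) - y)) \<longlonglongrightarrow> 0"
      proof (rule tendsto_sandwich[OF _ _ tendsto_const z])
        show "\<forall>\<^sub>F k in sequentially. M (\<sigma> (r k) - y) \<le>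
            inverse (real (Suc (r k))) + M (T (x (r k)) - y)"
          using M.triangle[of "\<sigma> (r k) - T (x (r k))" "T (x (r k)) - y" for k] \<sigma>x
          by (intro always_eventually allI) (smt (verit) diff_add_cancel add_diff_eq)
      qed (simp add: M.nonneg)
      then have "limitin S (\<sigma> \<circ> r) y sequentially" by (simp add: lim o_def)
      moreover have "y \<in> S closure_of ?I"
        unfolding cl mem_Collect_eq
      proof (intro allI impI)
        fix e :: real assume "e > 0"
        then have "\<forall>\<^sub>F k in sequentially. M (T (x (r k)) - y) < e"
          using y order_tendstoD(2) by blast
        then obtain k where "M (T (x (r k)) - y) < e"
          using eventually_happens trivial_limit_sequentially by blast
        then show "\<exists>v\<in>?I. M (y - v) < e"
          using x M.commute by force
      qed
      ultimately show "\<exists>l r. l \<in> S closure_of ?I \<and> strict_mono r \<and>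
          limitin S (\<sigma> \<circ> r) l sequentially" using r by blast
    qed
  next
    assume k: "compactin S (S closure_of ?I)"
    show "compact_operator N M T"
      unfolding compact_operator_def
    proof (intro allI impI)
      fix x :: "nat \<Rightarrow> 'x" assume "\<exists>C. \<forall>n. N (x n) \<le> C"
      then obtain C0 where C0: "\<And>n. N (x n) \<le> C0" by blast
      define C where "C = max C0 1"
      have C: "C > 0" "\<And>n. N (x n) \<le> C" using C0 by (auto simp: C_def max.coboundedI1)
      define u where "u n = (1 / C) *\<^sub>R x n" for n
      have u: "N (u n) \<le> 1" for n using C by (simp add: u_def N.scale)
      have "?I \<subseteq> S closure_of ?I"
        by (rule closure_of_subset) (simp add: S_def)
      then have "range (T \<circ> u) \<subseteq> S closure_of ?I" using u by auto
      then obtain l r where r: "strict_mono r" and "limitin S ((T \<circ> u) \<circ> r) l sequentially"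
        using k unfolding cpt by blast
      then have l: "(\<lambda>k. M (T (u (r k)) - l)) \<longlonglongrightarrow> 0" by (simp add: lim o_def)
      have "M (T (x (r k)) - C *\<^sub>R l) = C * M (T (u (r k)) - l)" for k
      proof -
        have "C *\<^sub>R (T (u (r k)) - l) = T (x (r k)) - C *\<^sub>R l"
          using C(1) by (simp add: u_def linear_scale[OF T] scaleR_diff_right)
        then show ?thesis using M.scale[of C "T (u (r k)) - l"] C(1) by simp
      qed
      then have "(\<lambda>k. M (T (x (r k)) - C *\<^sub>R l)) \<longlonglongrightarrow> 0"
        using tendsto_mult_right_zero[OF l, of C] by simp
      then show "\<exists>r y. strict_mono r \<and> (\<lambda>k. M (T (x (r k)) - y)) \<longlonglongrightarrow> 0"
        using r by blast
    qed
  qed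
qed

end

theory Submission
  imports Defs
begin

text \<open>In a Banach lattice with a strong unit \<open>e\<close>, norm bounded sequences of positive elements are
  order bounded: otherwise there are terms \<open>v n\<close> not below \<open>(n 2\<^sup>n) e\<close>, and the sum of
  the absolutely convergent series of the \<open>v n / 2\<^sup>n\<close> is not dominated by any multiple of \<open>e\<close>.
  Hence a sequence that is bounded in the mixed norm is \<open>p\<close>-bounded, and \<open>p\<close>-compactness gives a
  \<open>p\<close>-convergent subsequence of its image, which converges in the mixed norm by order continuity.\<close>

instance banach_lattice \<subseteq> banach ..

text \<open>The positive part of \<open>w - l\<close> lies below \<open>\<bar>s n - l\<bar>\<close>
  for all large \<open>n\<close>. The lattice norm is monotone, so the norm of this positive part is
  0 in the limit, which forces \<open>w - l \<le> 0\<close>.\<close>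

lemma normed_lattice_LIMSEQ_le_const:
  fixes s :: "nat \<Rightarrow> 'a::normed_lattice"
  assumes lim: "s \<longlonglongrightarrow> l" and le: "\<And>n. n \<ge> N \<Longrightarrow> w \<le> s n"
  shows "w \<le> l"
proof -
  define u where "u = sup (w - l) 0"
  have bound: "norm u \<le> norm (s n - l)" if "n \<ge> N" for n
  proof (rule norm_mono_abs)
    have "w - l \<le> s n - l" using le[OF that] by simp
    also have "\<dots> \<le> \<bar>s n - l\<bar>" by (rule abs_ge_self)
    finally have "u \<le> \<bar>s n - l\<bar>" unfolding u_def by (rule sup_least) simp
    moreover have "0 \<le> u" by (simp add: u_def)
    ultimately show "\<bar>u\<bar> \<le> \<bar>s n - l\<bar>" by simp
  qed
  have "(\<lambda>n. norm (s n - l)) \<longlonglongrightarrow> 0"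
    using lim by (simp add: LIM_zero tendsto_norm_zero)
  then have "norm u \<le> 0"
    by (rule LIMSEQ_le_const) (use bound in blast)
  then show ?thesis unfolding u_def by (metis norm_le_zero_iff sup_ge1 diff_le_0_iff_le)
qed

text \<open>The elements dominated by a nonnegative multiple of \<open>e\<close> form an order ideal
  containing \<open>e\<close>. They therefore include the ideal generated by \<open>e\<close>, which
  is the whole space.\<close>

lemma strong_unit_dominates:
  fixes e x :: "'a::vector_lattice"
  assumes "strong_unit e"
  obtains c where "0 \<le> c" "\<bar>x\<bar> \<le> c *\<^sub>R e"
proof -
  have e: "0 \<le> e" and gen: "generated_ideal {e} = UNIV"
    using assms by (auto simp: strong_unit_def)
  define I where "I = {x. \<exists>c\<ge>0. \<bar>x\<bar> \<le> c *\<^sub>R e}"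
  have "subspace I"
  proof (rule subspaceI)
    show "0 \<in> I" unfolding I_def by (auto intro!: exI[of _ 0])
    fix x assume "x \<in> I"
    then obtain c where c: "c \<ge> 0" "\<bar>x\<bar> \<le> c *\<^sub>R e" by (auto simp: I_def)
    show "x + y \<in> I" if y: "y \<in> I" for y
    proof -
      obtain d where d: "d \<ge> 0" "\<bar>y\<bar> \<le> d *\<^sub>R e" using y by (auto simp: I_def)
      have "\<bar>x + y\<bar> \<le> \<bar>x\<bar> + \<bar>y\<bar>" by (rule abs_triangle_ineq)
      also have "\<dots> \<le> (c + d) *\<^sub>R e" unfolding scaleR_add_left by (rule add_mono[OF c(2) d(2)])
      finally show ?thesis using c(1) d(1) unfolding I_def by (auto intro!: exI[of _ "c + d"])
    qed
    fix a :: real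
    \<comment> \<open>Depending on the sign of \<open>a\<close>, each of
      \<open>a *\<^sub>R x\<close> and its negative is \<open>\<bar>a\<bar>\<close> times
      \<open>x\<close> or \<open>- x\<close>. Both \<open>x\<close> and \<open>- x\<close> are
      admissible choices of \<open>z\<close>.\<close>
    have le: "b *\<^sub>R z \<le> (\<bar>a\<bar> * c) *\<^sub>R e" if "z \<le> \<bar>x\<bar>" "\<bar>a\<bar> = b" for b z
      unfolding scaleR_scaleR[symmetric] that(2)
      by (rule scaleR_left_mono[OF order_trans[OF that(1) c(2)]]) (use that in auto)
    have "\<bar>a *\<^sub>R x\<bar> \<le> (\<bar>a\<bar> * c) *\<^sub>R e"
    proof (rule abs_leI)
      show "a *\<^sub>R x \<le> (\<bar>a\<bar> * c) *\<^sub>R e"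
        using le[of x "\<bar>a\<bar>"] le[of "- x" "\<bar>a\<bar>"] by (cases "a \<ge> 0") (simp_all add: abs_ge_self abs_ge_minus_self)
      show "- (a *\<^sub>R x) \<le> (\<bar>a\<bar> * c) *\<^sub>R e"
        using le[of x "\<bar>a\<bar>"] le[of "- x" "\<bar>a\<bar>"] by (cases "a \<ge> 0") (simp_all add: abs_ge_self abs_ge_minus_self)
    qed
    then show "a *\<^sub>R x \<in> I"
      unfolding I_def using c(1) by (auto intro!: exI[of _ "\<bar>a\<bar> * c"])
  qed
  then have "order_ideal I"
    unfolding order_ideal_def I_def by (auto intro: order_trans)
  moreover have "e \<in> I" unfolding I_def using e by (auto intro!: exI[of _ 1])
  ultimately have "generated_ideal {e} \<subseteq> I" unfolding generated_ideal_def by auto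
  then show ?thesis using gen that unfolding I_def by blast
qed

lemma norm_bounded_imp_order_bounded:
  fixes u :: "nat \<Rightarrow> 'a::banach_lattice" and e :: 'a
  assumes e: "strong_unit e" and pos: "\<And>n. 0 \<le> u n" and bnd: "\<And>n. norm (u n) \<le> C"
  shows "\<exists>b. \<forall>n. u n \<le> b"
proof (rule ccontr)
  assume "\<not> ?thesis"
  then have "\<forall>n::nat. \<exists>k. \<not> u k \<le> (real n * 2 ^ n) *\<^sub>R e" by blast
  then obtain k where k: "\<And>n. \<not> u (k n) \<le> (real n * 2 ^ n) *\<^sub>R e" by metis
  define f where "f n = (1 / 2) ^ n *\<^sub>R u (k n)" for n
  have f0: "0 \<le> f n" for n
    unfolding f_def by (rule scaleR_nonneg_nonneg) (simp_all add: pos)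
  have "summable f"
  proof (rule summable_comparison_test')
    show "summable (\<lambda>n. C * (1 / 2) ^ n)"
      by (intro summable_mult summable_geometric) simp
    show "norm (f n) \<le> C * (1 / 2) ^ n" for n
      using mult_left_mono[OF bnd[of "k n"], of "(1 / 2) ^ n"] by (simp add: f_def mult.commute)
  qed
  then have lim: "(\<lambda>n. sum f {..<n}) \<longlonglongrightarrow> suminf f" by (rule summable_LIMSEQ)
  have f_le: "f n \<le> suminf f" for n
  proof (rule normed_lattice_LIMSEQ_le_const[OF lim])
    \<comment> \<open>From \<open>Suc n\<close> on, the partial sum contains the term
      \<open>f n\<close>; the other terms are nonnegative.\<close>
    show "f n \<le> sum f {..<N}" if "N \<ge> Suc n" for N
      using that f0 sum_mono2[of "{..<N}" "{n}" f] by simp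
  qed
  obtain c where c: "\<bar>suminf f\<bar> \<le> c *\<^sub>R e" using strong_unit_dominates[OF e] .
  obtain n :: nat where n: "c \<le> real n" using real_arch_simple by blast
  have "f n \<le> c *\<^sub>R e" using f_le[of n] c by (meson abs_ge_self order_trans)
  also have "\<dots> \<le> real n *\<^sub>R e"
    using n e by (intro scaleR_right_mono) (auto simp: strong_unit_def)
  \<comment> \<open>The factor \<open>2 ^ n\<close> undoes the weight in \<open>f n\<close>. What
    remains is exactly the bound that \<open>u (k n)\<close> was chosen to violate.\<close>
  finally have "2 ^ n *\<^sub>R f n \<le> 2 ^ n *\<^sub>R (real n *\<^sub>R e)"
    by (rule scaleR_left_mono) simp
  then have "u (k n) \<le> (real n * 2 ^ n) *\<^sub>R e"
    by (simp add: f_def power_divide mult.commute)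
  with k show False by blast
qed

theorem proposition8:
  fixes p :: "'x::real_vector \<Rightarrow> 'e::am_space"
    and m :: "'y::real_vector \<Rightarrow> 'f::normed_lattice"
    and T :: "'x \<Rightarrow> 'y"
  assumes "lattice_normed_space p"
    and "\<exists>e::'e. strong_unit e"
    and "lattice_normed_space m"
    and "order_continuous_norm TYPE('f)"
    and "linear T"
    and "sequentially_p_compact p m T"
  shows "compact_operator (mixed_norm p) (mixed_norm m) T"
  unfolding compact_operator_def
proof (intro allI impI)
  fix x :: "nat \<Rightarrow> 'x"
  assume "\<exists>C. \<forall>n. mixed_norm p (x n) \<le> C"
  then obtain C where "\<And>n. norm (p (x n)) \<le> C" by (auto simp: mixed_norm_def)
  moreover obtain e :: 'e where "strong_unit e" using assms(2) by blast
  ultimately have "p_bounded p x"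
    unfolding p_bounded_def
    using lattice_normed_space.nonneg[OF assms(1)] by (intro norm_bounded_imp_order_bounded)
  then obtain r y where r: "strict_mono r"
    and "p_converges m (UNIV :: nat set) (\<le>) (\<lambda>k. T (x (r k))) y"
    using assms(6) unfolding sequentially_p_compact_def by blast
  then have y: "order_converges (UNIV :: nat set) (\<le>) (\<lambda>k. m (T (x (r k)) - y)) 0"
    by (simp add: p_converges_def)
  \<comment> \<open>The subsequence is a net indexed by \<open>nat\<close> rather than by a subset
    of \<open>'f\<close>, so order continuity enters in its form for arbitrary index sets. Its
    conclusion is the \<epsilon>-criterion for a limit of a sequence.\<close>
  have "(\<lambda>k. mixed_norm m (T (x (r k)) - y)) \<longlonglongrightarrow> 0"
    unfolding mixed_norm_def LIMSEQ_iff
    using order_continuous_norm_any_net[OF assms(4) y] by auto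
  with r show "\<exists>r y. strict_mono r \<and> (\<lambda>k. mixed_norm m (T (x (r k)) - y)) \<longlonglongrightarrow> 0"
    by blast
qed

end
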